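(* Let $n\ge 1$ and let $\mathbb{F}_q$ be a finite field. The adjacency matrix of the unit-graph on $\operatorname{Mat}_n(\mathbb{F}_q)$ has at most $n+1$ distinct eigenvalues.
   Context: The unit-graph on $\operatorname{Mat}_n(\mathbb{F}_q)$ is the Cayley digraph $\operatorname{Cay}(\operatorname{Mat}_n(\mathbb{F}_q), \operatorname{GL}_n(\mathbb{F}_q))$: its vertex set is $\operatorname{Mat}_n(\mathbb{F}_q)$ and there is a directed edge from $A$ to $B$ iff $B - A$ is invertible; it is regarded as an undirected graph since $\operatorname{GL}_n(\mathbb{F}_q)$ is closed under negation. *)

theory Defs
  imports "HOL-Analysis.Analysis"
begin

text \<open>Adjacency matrix of the unit-graph Cay(Mat_n(F_q), GL_n(F_q)):
  rows and columns indexed by n x n matrices over the finite field 'a;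
  entry (A,B) is 1 iff B - A is invertible, else 0. Complex entries.\<close>
definition unit_graph_adjacency ::
  "complex ^ ('a::{field,finite} ^'n::finite^'n) ^ ('a^'n^'n)" where
  "unit_graph_adjacency = (\<chi> A B. if invertible (B - A) then 1 else 0)"

text \<open>Eigenvalue of a square matrix (over the complex numbers).\<close>
definition is_eigenvalue :: "complex ^'m::finite ^'m \<Rightarrow> complex \<Rightarrow> bool" where
  "is_eigenvalue M c \<longleftrightarrow> (\<exists>v. v \<noteq> 0 \<and> M *v v = c *s v)"

end

theory Submission
  imports Defs
begin

text \<open>
  Every power of the adjacency matrix has an \<open>(A, B)\<close> entry that depends only on the rank
  of \<open>B - A\<close>. This holds for the identity and survives multiplication by the adjacency
  matrix because two matrices of equal rank are equivalent, \<open>Y' = P Y Q\<close>, and the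
  substitution \<open>X \<mapsto> P X Q\<close> permutes the matrices while preserving ranks and invertibility
  of differences. Since there are only \<open>n + 1\<close> ranks, the first \<open>n + 2\<close> powers satisfy a
  nontrivial linear relation, i.e. the adjacency matrix is annihilated by a nonzero polynomial
  of degree at most \<open>n + 1\<close>, and every eigenvalue is one of its roots.
\<close>

section \<open>Linear maps of equal rank are equivalent\<close>

lemma vec_rank_nullity:
  fixes f :: "'a::field^'n \<Rightarrow> 'a^'m"
  assumes lf: "Vector_Spaces.linear (*s) (*s) f"
  shows "vec.dim {x. f x = 0} + vec.dim (range f) = CARD('n)"
proof -
  interpret lf: Vector_Spaces.linear "(*s)" "(*s)" f by (rule lf)
  obtain E where E: "E \<subseteq> range f" "vec.independent E" "range f \<subseteq> vec.span E"
      "card E = vec.dim (range f)"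
    by (rule vec.basis_exists)
  obtain S where S: "f ` S = E" "inj_on f S"
    using E(1) unfolding subset_image_inj by blast
  have fin: "finite S" using S vec.finiteI_independent[OF E(2)] finite_image_iff by blast
  have dim_span: "vec.dim (vec.span S) = card E"
    using vec.dim_le_card[of "vec.span S" S] vec.dim_image_le[OF lf, of S] fin S
      card_image vec.dim_eq_card_independent[OF E(2)] by fastforce
  have ker_Int: "{x. f x = 0} \<inter> vec.span S = {0}"
    using vec.linear_indep_image_lemma[OF lf fin _ S(2)] S(1) E(2) vec.span_zero by auto
  have ker_sum: "{x + y |x y. x \<in> {x. f x = 0} \<and> y \<in> vec.span S} = UNIV"
  proof safe
    fix w
    have "f w \<in> f ` vec.span S"
      using E(3) vec.linear_span_image[OF lf, of S] S(1) by auto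
    then obtain s where s: "s \<in> vec.span S" "f w = f s" by auto
    then have "f (w - s) = 0" by (simp add: lf.diff)
    with s show "\<exists>x y. w = x + y \<and> x \<in> {x. f x = 0} \<and> y \<in> vec.span S"
      by (intro exI[of _ "w - s"] exI[of _ s]) auto
  qed simp
  have "vec.subspace {x. f x = 0}"
    unfolding vec.subspace_def using lf.add lf.scale lf.zero by auto
  from vec.dim_sums_Int[OF this vec.subspace_span, of S]
  show ?thesis
    using ker_sum ker_Int dim_span E(4) vec_dim_card[where 'a='a and 'n='n] by simp
qed

lemma linear_surj_if_kernel_in_range:
  fixes F :: "'a::field^'n \<Rightarrow> 'a^'m" and h :: "'a^'n \<Rightarrow> 'a^'n"
  assumes lF: "Vector_Spaces.linear (*s) (*s) F" and lh: "Vector_Spaces.linear (*s) (*s) h"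
    and ker: "{x. F x = 0} \<subseteq> range h" and ran: "range F \<subseteq> range (F \<circ> h)"
  shows "surj h"
proof -
  interpret lF: Vector_Spaces.linear "(*s)" "(*s)" F by (rule lF)
  interpret lh: Vector_Spaces.linear "(*s)" "(*s)" h by (rule lh)
  have "w \<in> range h" for w
  proof -
    obtain u where "F w = F (h u)" using ran by auto
    then have "w - h u \<in> range h" using ker by (auto simp: lF.diff)
    then obtain u' where "w = h u + h u'" by (metis diff_add_cancel rangeE add.commute)
    then show ?thesis by (metis lh.add rangeI)
  qed
  then show ?thesis by auto
qed

lemma linear_lift_covering_kernel:
  fixes F g :: "'a::field^'n \<Rightarrow> 'a^'m"
  assumes lF: "Vector_Spaces.linear (*s) (*s) F" and lg: "Vector_Spaces.linear (*s) (*s) g"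
    and range_le: "range g \<subseteq> range F"
    and same_kernel_dim: "vec.dim {x. g x = 0} = vec.dim {x. F x = 0}"
  shows "\<exists>h. Vector_Spaces.linear (*s) (*s) h \<and> g = F \<circ> h \<and> {x. F x = 0} \<subseteq> range h"
proof -
  obtain K where K: "K \<subseteq> {x. g x = 0}" "vec.independent K" "card K = vec.dim {x. g x = 0}"
    by (metis vec.basis_exists)
  obtain L where L: "L \<subseteq> {x. F x = 0}" "vec.independent L" "{x. F x = 0} \<subseteq> vec.span L"
      "card L = vec.dim {x. F x = 0}"
    by (rule vec.basis_exists)
  obtain \<sigma> where \<sigma>: "bij_betw \<sigma> K L"
    using K L same_kernel_dim vec.finiteI_independent by (metis bij_betw_iff_card)
  have preimage: "F (inv F (g b)) = g b" for b
    by (rule f_inv_into_f) (use range_le in auto)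
  define B where "B = vec.extend_basis K"
  have B: "vec.independent B" "K \<subseteq> B" "vec.span B = UNIV"
    unfolding B_def using K(2) vec.independent_extend_basis vec.extend_basis_superset
      vec.span_extend_basis by auto
  define h where "h = vec.construct B (\<lambda>b. if b \<in> K then \<sigma> b else inv F (g b))"
  have lh: "Vector_Spaces.linear (*s) (*s) h"
    unfolding h_def by (rule vec.linear_construct[OF B(1)])
  have h_basis: "h b = (if b \<in> K then \<sigma> b else inv F (g b))" if "b \<in> B" for b
    unfolding h_def using vec.construct_basis[OF B(1) that] .
  have "g b = F (h b)" if "b \<in> B" for b
  proof (cases "b \<in> K")
    case True
    then have "g b = 0" "F (\<sigma> b) = 0"
      using bij_betwE[OF \<sigma>] K(1) L(1) by blast+
    then show ?thesis using True h_basis[OF that] by simp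
  qed (use h_basis[OF that] preimage in simp)
  then have "g = F \<circ> h"
    using vec.linear_eq_on[OF lg Vector_Spaces.linear_compose[OF lh lF]] B(3) by fastforce
  moreover have "h ` K = \<sigma> ` K"
    by (rule image_cong) (use h_basis B(2) in auto)
  then have "vec.span L \<subseteq> vec.span (range h)"
    using \<sigma> by (intro vec.span_mono) (auto simp: bij_betw_def)
  then have "{x. F x = 0} \<subseteq> range h"
    using L(3) vec.linear_span_image[OF lh, of UNIV] by (simp add: vec.span_UNIV)
  ultimately show ?thesis using lh by blast
qed

lemma linear_factor_through_same_range:
  fixes F g :: "'a::field^'n \<Rightarrow> 'a^'m"
  assumes lF: "Vector_Spaces.linear (*s) (*s) F" and lg: "Vector_Spaces.linear (*s) (*s) g"
    and same_range: "range F = range g"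
  shows "\<exists>h. Vector_Spaces.linear (*s) (*s) h \<and> bij h \<and> g = F \<circ> h"
proof -
  have "vec.dim {x. g x = 0} = vec.dim {x. F x = 0}"
    using vec_rank_nullity[OF lF] vec_rank_nullity[OF lg] same_range by simp
  then obtain h where h: "Vector_Spaces.linear (*s) (*s) h" "g = F \<circ> h" "{x. F x = 0} \<subseteq> range h"
    using linear_lift_covering_kernel[OF lF lg] same_range by blast
  then have "surj h"
    using linear_surj_if_kernel_in_range[OF lF] same_range by simp
  then show ?thesis
    using h vec.linear_surj_imp_inj[OF h(1)] by (auto simp: bij_def)
qed

lemma linear_equivalent_if_same_dim_range:
  fixes f g :: "'a::field^'n \<Rightarrow> 'a^'m"
  assumes lf: "Vector_Spaces.linear (*s) (*s) f" and lg: "Vector_Spaces.linear (*s) (*s) g"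
    and same_dim: "vec.dim (range f) = vec.dim (range g)"
  shows "\<exists>h1 h2. Vector_Spaces.linear (*s) (*s) h1 \<and> bij h1
    \<and> Vector_Spaces.linear (*s) (*s) h2 \<and> bij h2 \<and> g = h1 \<circ> f \<circ> h2"
proof -
  obtain E where E: "E \<subseteq> range f" "vec.independent E" "range f \<subseteq> vec.span E"
      "card E = vec.dim (range f)"
    by (rule vec.basis_exists)
  obtain E' where E': "E' \<subseteq> range g" "vec.independent E'" "range g \<subseteq> vec.span E'"
      "card E' = vec.dim (range g)"
    by (rule vec.basis_exists)
  obtain \<tau> where \<tau>: "bij_betw \<tau> E E'"
    using E E' same_dim vec.finiteI_independent by (metis bij_betw_iff_card)
  then obtain h1 where h1: "Vector_Spaces.linear (*s) (*s) h1" "inj h1" "\<forall>x\<in>E. h1 x = \<tau> x"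
    using vec.linear_independent_extend_inj[OF E(2), of \<tau>] E'(2) by (auto simp: bij_betw_def)
  have "h1 ` E = E'"
    using h1(3) \<tau> by (metis bij_betw_imp_surj_on image_cong)
  have span_range: "vec.span (range f) = range f" "vec.span (range g) = range g"
    using vec.linear_span_image[OF lf, of UNIV] vec.linear_span_image[OF lg, of UNIV]
    by (simp_all add: vec.span_UNIV del: vec.span_eq_iff)
  have range_span: "range f = vec.span E" "range g = vec.span E'"
    using vec.span_mono[OF E(1)] vec.span_mono[OF E'(1)] E(3) E'(3)
    unfolding span_range by auto
  have "range (h1 \<circ> f) = h1 ` vec.span E"
    by (metis image_comp range_span(1))
  also have "\<dots> = range g"
    using range_span vec.linear_span_image[OF h1(1), of E] \<open>h1 ` E = E'\<close> by simp
  finally have "range (h1 \<circ> f) = range g" .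
  then obtain h2 where "Vector_Spaces.linear (*s) (*s) h2" "bij h2" "g = (h1 \<circ> f) \<circ> h2"
    using linear_factor_through_same_range[OF Vector_Spaces.linear_compose[OF lf h1(1)] lg] by blast
  moreover have "bij h1"
    using h1 vec.linear_inj_imp_surj by (auto simp: bij_def)
  ultimately show ?thesis using h1(1) by blast
qed

section \<open>Matrices of equal rank are equivalent\<close>

text \<open>The library's \<open>rank\<close> is the row rank; its equality with the column rank is only
  proved for real matrices.\<close>

definition col_rank :: "'a::field^'n^'m \<Rightarrow> nat" where
  "col_rank X = vec.dim (range ((*v) X))"

lemma invertible_matrix_of_linear_bij:
  fixes h :: "'a::field^'n \<Rightarrow> 'a^'n"
  assumes lh: "Vector_Spaces.linear (*s) (*s) h" and "bij h"
  shows "invertible (matrix h)"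
proof -
  obtain k where "Vector_Spaces.linear (*s) (*s) k" "h \<circ> k = id"
    using vec.linear_surjective_right_inverse[OF lh] \<open>bij h\<close> bij_is_surj by blast
  then have "\<exists>B. matrix h ** B = mat 1"
    using matrix_right_invertible_gen[OF lh] by blast
  then show ?thesis using invertible_right_inverse by blast
qed

lemma equivalent_if_col_rank_eq:
  fixes X Y :: "'a::field^'n^'m"
  assumes "col_rank X = col_rank Y"
  shows "\<exists>P Q. invertible P \<and> invertible Q \<and> Y = P ** X ** Q"
proof -
  obtain h1 h2 where h: "Vector_Spaces.linear (*s) (*s) h1" "bij h1"
      "Vector_Spaces.linear (*s) (*s) h2" "bij h2" "(*v) Y = h1 \<circ> (*v) X \<circ> h2"
    using linear_equivalent_if_same_dim_range[OF matrix_vector_mul_linear_gen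
        matrix_vector_mul_linear_gen, of X Y] assms
    unfolding col_rank_def by blast
  have "Y *v x = (matrix h1 ** X ** matrix h2) *v x" for x
    using fun_cong[OF h(5), of x]
    by (simp add: matrix_works[OF h(1)] matrix_works[OF h(3)] matrix_vector_mul_assoc[symmetric])
  then have "Y = matrix h1 ** X ** matrix h2"
    by (simp add: matrix_eq)
  moreover have "invertible (matrix h1)" "invertible (matrix h2)"
    using invertible_matrix_of_linear_bij h(1-4) by blast+
  ultimately show ?thesis by blast
qed

lemma col_rank_mult_invertible:
  fixes X :: "'a::field^'n^'m" and P :: "'a^'m^'m" and Q :: "'a^'n^'n"
  assumes P: "invertible P" and Q: "invertible Q"
  shows "col_rank (P ** X ** Q) = col_rank X"
proof -
  have "surj ((*v) Q)"
    using Q matrix_right_invertible_surjective[of Q] by (simp add: invertible_right_inverse)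
  moreover have "(*v) (P ** X ** Q) = (*v) P \<circ> (*v) X \<circ> (*v) Q"
    by (simp add: fun_eq_iff matrix_vector_mul_assoc matrix_mul_assoc)
  ultimately have "range ((*v) (P ** X ** Q)) = (*v) P ` range ((*v) X)"
    by (metis image_comp)
  moreover have "inj ((*v) P)"
    using P matrix_left_invertible_injective[of P] by (simp add: invertible_left_inverse)
  ultimately show ?thesis
    unfolding col_rank_def
    using vec.dim_image_eq[OF matrix_vector_mul_linear_gen inj_on_subset[OF _ subset_UNIV]] by simp
qed

lemma col_rank_le: "col_rank (X::'a::field^'n^'m) \<le> CARD('m)"
  unfolding col_rank_def by (rule dim_subset_UNIV_cart_gen)

lemma col_rank_eq_0_iff: "col_rank (X::'a::field^'n^'m) = 0 \<longleftrightarrow> X = 0"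
proof
  assume "col_rank X = 0"
  then have "range ((*v) X) \<subseteq> {0}"
    unfolding col_rank_def by simp
  then show "X = 0"
    unfolding matrix_eq by auto
qed (simp add: col_rank_def)

lemma invertible_iff_col_rank: "invertible (X::'a::field^'n^'n) \<longleftrightarrow> col_rank X = CARD('n)"
proof -
  have "col_rank X = CARD('n) \<longleftrightarrow> surj ((*v) X)"
    unfolding col_rank_def using vec.dim_eq_full
    by (metis vec.span_image vec.span_UNIV vec_dim_card vec.dimension_def vec.dim_UNIV)
  then show ?thesis
    using matrix_right_invertible_surjective[of X] by (simp add: invertible_right_inverse)
qed

section \<open>Functions of the rank\<close>

definition rank_invariant :: "('a::field^'n^'m \<Rightarrow> 'b) \<Rightarrow> bool" where
  "rank_invariant f \<longleftrightarrow> (\<forall>X Y. col_rank X = col_rank Y \<longrightarrow> f X = f Y)"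

lemma bij_mult_invertible:
  fixes P :: "'a::field^'m^'m" and Q :: "'a^'n^'n"
  assumes "invertible P" "invertible Q"
  shows "bij (\<lambda>Z::'a^'n^'m. P ** Z ** Q)"
proof -
  obtain P' Q' where "P' ** P = mat 1" "P ** P' = mat 1" "Q' ** Q = mat 1" "Q ** Q' = mat 1"
    using assms unfolding invertible_def by blast
  then have "(\<lambda>Z. P' ** Z ** Q') \<circ> (\<lambda>Z. P ** Z ** Q) = id"
    "(\<lambda>Z. P ** Z ** Q) \<circ> (\<lambda>Z. P' ** Z ** Q') = id"
    by (simp_all add: fun_eq_iff matrix_mul_assoc) (simp_all add: matrix_mul_assoc[symmetric])
  then show ?thesis by (rule o_bij)
qed

lemma matrix_mult_diff_both:
  fixes P :: "'a::field^'m^'m" and Y Z :: "'a^'n^'m" and Q :: "'a^'n^'n"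
  shows "P ** Y ** Q - P ** Z ** Q = P ** (Y - Z) ** Q"
  unfolding matrix_eq
  by (simp add: matrix_vector_mul_assoc[symmetric] matrix_vector_mult_diff_rdistrib
      matrix_vector_mult_diff_distrib)

lemma rank_invariant_convolution:
  fixes f g :: "'a::{field,finite}^'n^'m \<Rightarrow> 'b::comm_semiring_0"
  assumes f: "rank_invariant f" and g: "rank_invariant g"
  shows "rank_invariant (\<lambda>Y. \<Sum>X\<in>UNIV. f X * g (Y - X))"
  unfolding rank_invariant_def
proof (intro allI impI)
  fix Y Y' :: "'a^'n^'m"
  assume "col_rank Y = col_rank Y'"
  then obtain P Q where PQ: "invertible P" "invertible Q" "Y' = P ** Y ** Q"
    using equivalent_if_col_rank_eq by blast
  have "bij_betw (\<lambda>Z. P ** Z ** Q) UNIV UNIV"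
    using bij_mult_invertible[OF PQ(1,2)] by (simp add: bij_def)
  then have "(\<Sum>X\<in>UNIV. f X * g (Y' - X)) = (\<Sum>Z\<in>UNIV. f (P ** Z ** Q) * g (Y' - P ** Z ** Q))"
    by (rule sum.reindex_bij_betw[symmetric])
  also have "\<dots> = (\<Sum>Z\<in>UNIV. f Z * g (Y - Z))"
  proof (rule sum.cong)
    fix Z
    have "f (P ** Z ** Q) = f Z" "g (P ** (Y - Z) ** Q) = g (Y - Z)"
      using f g col_rank_mult_invertible[OF PQ(1,2)] unfolding rank_invariant_def by blast+
    then show "f (P ** Z ** Q) * g (Y' - P ** Z ** Q) = f Z * g (Y - Z)"
      unfolding PQ(3) matrix_mult_diff_both by simp
  qed simp
  finally show "(\<Sum>X\<in>UNIV. f X * g (Y - X)) = (\<Sum>X\<in>UNIV. f X * g (Y' - X))" by simp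
qed

lemma rank_invariant_in_span_of_rank_indicators:
  fixes v :: "'b::field^('a::{field,finite}^'n^'m)"
  assumes "rank_invariant (\<lambda>X. v $ X)"
  shows "v \<in> vec.span ((\<lambda>r. \<chi> X. if col_rank X = r then 1 else 0) ` {..CARD('m)})"
proof -
  define E where "E r = (\<chi> X::'a^'n^'m. if col_rank X = r then 1 else (0::'b))" for r
  define c where "c r = v $ (SOME X. col_rank X = r)" for r
  have "(\<Sum>r\<le>CARD('m). c r *s E r) $ X = v $ X" for X
  proof -
    have "(\<Sum>r\<le>CARD('m). c r *s E r) $ X = c (col_rank X)"
      using col_rank_le[of X] by (simp add: E_def if_distrib cong: if_cong)
    also have "\<dots> = v $ X"
      using assms someI[of "\<lambda>Y. col_rank Y = col_rank X" X]
      unfolding c_def rank_invariant_def by blast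
    finally show ?thesis .
  qed
  then have "v = (\<Sum>r\<le>CARD('m). c r *s E r)"
    by (simp add: vec_eq_iff)
  also have "\<dots> \<in> vec.span (E ` {..CARD('m)})"
    by (intro vec.span_sum vec.span_scale vec.span_base) auto
  finally show ?thesis unfolding E_def .
qed

section \<open>Powers of the adjacency matrix\<close>

fun matpow :: "'a::semiring_1^'m^'m \<Rightarrow> nat \<Rightarrow> 'a^'m^'m" where
  "matpow M 0 = mat 1"
| "matpow M (Suc k) = matpow M k ** M"

lemma matpow_eigenvector:
  fixes M :: "'a::field^'m^'m"
  assumes "M *v v = c *s v"
  shows "matpow M k *v v = c ^ k *s v"
proof (induction k)
  case (Suc k)
  have "matpow M (Suc k) *v v = matpow M k *v (c *s v)"
    using assms by (simp add: matrix_vector_mul_assoc[symmetric])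
  also have "\<dots> = c ^ Suc k *s v"
    using Suc by (simp add: vector_scalar_commute)
  finally show ?case .
qed simp

lemma unit_graph_adjacency_power_rank_invariant:
  "\<exists>f. rank_invariant f \<and> (\<forall>A B.
     matpow (unit_graph_adjacency :: complex ^ ('a::{field,finite}^'n::finite^'n) ^ ('a^'n^'n)) k $ A $ B
       = f (B - A))"
proof (induction k)
  case 0
  have "rank_invariant (\<lambda>X::'a^'n^'n. if X = 0 then 1 else (0::complex))"
    unfolding rank_invariant_def by (simp add: col_rank_eq_0_iff[symmetric])
  then show ?case
    by (intro exI[of _ "\<lambda>X. if X = 0 then 1 else 0"]) (auto simp: mat_def)
next
  case (Suc k)
  then obtain f where f: "rank_invariant f"
    "\<And>A B. matpow (unit_graph_adjacency :: complex ^ ('a^'n^'n) ^ ('a^'n^'n)) k $ A $ B = f (B - A)"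
    by blast
  define unit :: "'a^'n^'n \<Rightarrow> complex" where "unit X = (if invertible X then 1 else 0)" for X
  have "rank_invariant unit"
    unfolding rank_invariant_def unit_def invertible_iff_col_rank by simp
  then have "rank_invariant (\<lambda>Y. \<Sum>X\<in>UNIV. f X * unit (Y - X))"
    using f(1) by (rule rank_invariant_convolution[rotated])
  moreover have "matpow unit_graph_adjacency (Suc k) $ A $ B = (\<Sum>X\<in>UNIV. f X * unit (B - A - X))"
    for A B :: "'a^'n^'n"
  proof -
    have entry: "unit_graph_adjacency $ C $ B = unit (B - C)" for C
      by (simp add: unit_graph_adjacency_def unit_def)
    have translation: "bij_betw (\<lambda>X. A + X) UNIV UNIV"
      by (rule bij_betwI[of _ _ _ "\<lambda>C. C - A"]) auto
    have "matpow unit_graph_adjacency (Suc k) $ A $ B = (\<Sum>C\<in>UNIV. f (C - A) * unit (B - C))"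
      by (simp add: matrix_matrix_mult_def f(2) entry)
    also have "\<dots> = (\<Sum>X\<in>UNIV. f (A + X - A) * unit (B - (A + X)))"
      by (rule sum.reindex_bij_betw[OF translation, symmetric])
    also have "\<dots> = (\<Sum>X\<in>UNIV. f X * unit (B - A - X))"
      by (simp add: diff_diff_eq)
    finally show ?thesis .
  qed
  ultimately show ?case by blast
qed

section \<open>An annihilating polynomial\<close>

lemma vec_family_dependent:
  fixes w :: "nat \<Rightarrow> 'a::field^'n"
  assumes "vec.dim (w ` {..<m}) < m"
  shows "\<exists>a. (\<exists>k<m. a k \<noteq> 0) \<and> (\<Sum>k<m. a k *s w k) = 0"
proof (cases "inj_on w {..<m}")
  case True
  have "vec.dependent (w ` {..<m})"
    by (rule vec.dependent_biggerset_general) (use assms True in \<open>simp add: card_image\<close>)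
  then obtain u where u: "\<exists>v\<in>w ` {..<m}. u v \<noteq> 0" "(\<Sum>v\<in>w ` {..<m}. u v *s v) = 0"
    using vec.dependent_finite[of "w ` {..<m}"] by auto
  have "(\<Sum>k<m. u (w k) *s w k) = 0"
    using u(2) sum.reindex[OF True, of "\<lambda>v. u v *s v"] by simp
  moreover have "\<exists>k<m. u (w k) \<noteq> 0"
    using u(1) by blast
  ultimately show ?thesis
    by (intro exI[of _ "\<lambda>k. u (w k)"]) blast
next
  case False
  then obtain j k where jk: "j < m" "k < m" "j \<noteq> k" "w j = w k"
    unfolding inj_on_def by auto
  define a :: "nat \<Rightarrow> 'a" where "a i = (if i = j then 1 else if i = k then - 1 else 0)" for i
  have "(\<Sum>i<m. a i *s w i) = (\<Sum>i\<in>{j, k}. a i *s w i)"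
    by (rule sum.mono_neutral_right) (use jk in \<open>auto simp: a_def\<close>)
  also have "\<dots> = 0"
    using jk by (simp add: a_def)
  finally show ?thesis
    using jk(1) by (intro exI[of _ a]) (auto simp: a_def)
qed

lemma eigenvalue_root_of_annihilating:
  fixes M :: "'a::field^'m^'m"
  assumes annihilating: "\<And>A B. (\<Sum>k<m. a k * matpow M k $ A $ B) = 0"
    and eigen: "M *v v = c *s v" "v \<noteq> 0"
  shows "(\<Sum>k<m. a k * c ^ k) = 0"
proof -
  have "(\<Sum>k<m. a k *s (matpow M k *v v)) = (\<Sum>k<m. a k * c ^ k) *s v"
    by (simp add: matpow_eigenvector[OF eigen(1)] vec.scale_sum_left mult.assoc)
  moreover have "(\<Sum>k<m. a k *s (matpow M k *v v)) = 0"
  proof -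
    have "(\<Sum>k<m. a k * (\<Sum>B\<in>UNIV. matpow M k $ A $ B * v $ B))
        = (\<Sum>B\<in>UNIV. (\<Sum>k<m. a k * matpow M k $ A $ B) * v $ B)" for A
      by (simp add: sum_distrib_left sum_distrib_right mult.assoc sum.swap[of _ "{..<m}"])
    then show ?thesis
      by (simp add: vec_eq_iff sum_component matrix_vector_mult_def annihilating)
  qed
  ultimately show ?thesis
    using eigen(2) by simp
qed

lemma roots_of_coefficients_bound:
  fixes a :: "nat \<Rightarrow> 'a::idom"
  assumes "\<exists>k<m. a k \<noteq> 0"
  shows "finite {x. (\<Sum>k<m. a k * x ^ k) = 0} \<and> card {x. (\<Sum>k<m. a k * x ^ k) = 0} \<le> m - 1"
proof -
  define p where "p = (\<Sum>k<m. monom (a k) k)"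
  have coeff_p: "coeff p k = (if k < m then a k else 0)" for k
    unfolding p_def coeff_sum by (auto simp: coeff_monom)
  have "p \<noteq> 0"
    using assms coeff_p by (metis coeff_0)
  moreover have "degree p \<le> m - 1"
    by (rule degree_le) (auto simp: coeff_p)
  moreover have "{x. (\<Sum>k<m. a k * x ^ k) = 0} = {x. poly p x = 0}"
    by (simp add: p_def poly_sum poly_monom)
  ultimately show ?thesis
    using poly_roots_finite card_poly_roots_bound by (metis order_trans)
qed

lemma rank_invariant_family_dependent:
  fixes F :: "nat \<Rightarrow> 'a::{field,finite}^'n^'m \<Rightarrow> 'b::field"
  assumes "\<And>k. rank_invariant (F k)"
  shows "\<exists>a. (\<exists>k<CARD('m) + 2. a k \<noteq> 0) \<and> (\<forall>X. (\<Sum>k<CARD('m) + 2. a k * F k X) = 0)"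
proof -
  let ?m = "CARD('m) + 2"
  define w where "w k = (\<chi> X. F k X)" for k
  define E where "E r = (\<chi> X::'a^'n^'m. if col_rank X = r then 1 else (0::'b))" for r
  have "w k \<in> vec.span (E ` {..CARD('m)})" for k
    using rank_invariant_in_span_of_rank_indicators[of "w k"] assms
    unfolding w_def E_def by simp
  then have "w ` {..<?m} \<subseteq> vec.span (E ` {..CARD('m)})"
    by blast
  then have "vec.dim (w ` {..<?m}) \<le> card (E ` {..CARD('m)})"
    by (rule vec.dim_le_card) simp
  also have "\<dots> < ?m"
    using card_image_le[of "{..CARD('m)}" E] by simp
  finally obtain a where a: "\<exists>k<?m. a k \<noteq> 0" "(\<Sum>k<?m. a k *s w k) = 0"
    using vec_family_dependent by blast
  have "(\<Sum>k<?m. a k * F k X) = 0" for X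
    using arg_cong[OF a(2), of "\<lambda>v. v $ X"] by (simp add: w_def sum_component)
  with a(1) show ?thesis by blast
qed

theorem proposition3p2:
  shows "finite {c. is_eigenvalue (unit_graph_adjacency :: complex ^ ('a::{field,finite}^'n::finite^'n) ^ ('a^'n^'n)) c}
       \<and> card {c. is_eigenvalue (unit_graph_adjacency :: complex ^ ('a::{field,finite}^'n::finite^'n) ^ ('a^'n^'n)) c}
           \<le> CARD('n) + 1"
proof -
  let ?M = "unit_graph_adjacency :: complex ^ ('a^'n^'n) ^ ('a^'n^'n)"
  let ?m = "CARD('n) + 2"
  obtain F where F: "\<And>k. rank_invariant (F k)" "\<And>k A B. matpow ?M k $ A $ B = F k (B - A)"
    using unit_graph_adjacency_power_rank_invariant by metis
  obtain a where a: "\<exists>k<?m. a k \<noteq> 0" "\<And>X. (\<Sum>k<?m. a k * F k X) = 0"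
    using rank_invariant_family_dependent[of F, OF F(1)] by blast
  then have "(\<Sum>k<?m. a k * matpow ?M k $ A $ B) = 0" for A B
    by (simp add: F(2))
  then have eigenvalues_roots: "{c. is_eigenvalue ?M c} \<subseteq> {x. (\<Sum>k<?m. a k * x ^ k) = 0}"
    using eigenvalue_root_of_annihilating unfolding is_eigenvalue_def by blast
  obtain roots_finite: "finite {x. (\<Sum>k<?m. a k * x ^ k) = 0}"
    and roots_card: "card {x. (\<Sum>k<?m. a k * x ^ k) = 0} \<le> ?m - 1"
    using roots_of_coefficients_bound[OF a(1)] by blast
  show ?thesis
    using finite_subset[OF eigenvalues_roots roots_finite]
      card_mono[OF roots_finite eigenvalues_roots] roots_card by linarith
qed

end
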